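(* Let $m\ge2$ be an integer, $n_1,\ldots,n_m\in\mathbb{N}_{\ge1}$ and $p_1,\ldots,p_m\in(0,1)$ with $p_1+\cdots+p_m=1$. Let $(A_2,\ldots,A_m)$ have a negative multinomial distribution with parameters $(n_1;p_2,\ldots,p_m)$ and let $(X_2,\ldots,X_m)\sim\operatorname{ID}(n_2,\ldots,n_m;n_1)$. Then $$\mathbb{P}(A_2\le n_2-1,\ldots,A_m\le n_m-1)=\mathbb{P}\left(X_2>\frac{p_2}{p_1},\ldots,X_m>\frac{p_m}{p_1}\right).$$
   Context: Negative multinomial distribution with parameters $(n_1;p_2,\ldots,p_m)$, where $p_1=1-\sum_{k=2}^m p_k$: for all integers $k_2,\ldots,k_m\ge0$, $$\mathbb{P}(A_2=k_2,\ldots,A_m=k_m)=\frac{(n_1+k_2+\cdots+k_m-1)!}{(n_1-1)!\,k_2!\cdots k_m!}\,p_1^{n_1}\prod_{\ell=2}^m p_\ell^{k_\ell}.$$ Inverted Dirichlet distribution $\operatorname{ID}(n_2,\ldots,n_m;n_1)$: the distribution on $[0,\infty)^{m-1}$ with density $$(s_2,\ldots,s_m)\mapsto\frac{\Gamma\big(\sum_{k=1}^m n_k\big)}{\prod_{k=1}^m\Gamma(n_k)}\cdot\frac{\prod_{k=2}^m s_k^{n_k-1}}{\big(1+\sum_{k=2}^m s_k\big)^{\sum_{k=1}^m n_k}}.$$ *)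

theory Defs
  imports "HOL-Probability.Probability"
begin

text \<open>A random vector \<open>(Y\<^sub>2, \<dots>, Y\<^sub>m)\<close> is a family \<open>Y\<close> of which only the components with index
  in \<open>{2..m}\<close> matter. Parameters are families indexed by \<open>{1..m}\<close>.\<close>

definition neg_multinomial_mass ::
    "nat \<Rightarrow> nat \<Rightarrow> (nat \<Rightarrow> real) \<Rightarrow> (nat \<Rightarrow> nat) \<Rightarrow> real" where
  "neg_multinomial_mass m n1 p k =
     fact (n1 + (\<Sum>l=2..m. k l) - 1) / (fact (n1 - 1) * (\<Prod>l=2..m. fact (k l)))
       * (1 - (\<Sum>l=2..m. p l)) ^ n1 * (\<Prod>l=2..m. p l ^ k l)"

definition neg_multinomial ::
    "'a measure \<Rightarrow> nat \<Rightarrow> (nat \<Rightarrow> 'a \<Rightarrow> nat) \<Rightarrow> nat \<Rightarrow> (nat \<Rightarrow> real) \<Rightarrow> bool" where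
  "neg_multinomial M m A n1 p \<longleftrightarrow>
     (\<forall>l\<in>{2..m}. A l \<in> measurable M (count_space UNIV)) \<and>
     (\<forall>k. \<P>(\<omega> in M. \<forall>l\<in>{2..m}. A l \<omega> = k l) = neg_multinomial_mass m n1 p k)"

definition inverted_dirichlet_density :: "nat \<Rightarrow> (nat \<Rightarrow> nat) \<Rightarrow> (nat \<Rightarrow> real) \<Rightarrow> real" where
  "inverted_dirichlet_density m n s =
     (if \<forall>k\<in>{2..m}. 0 \<le> s k
      then Gamma (real (\<Sum>k=1..m. n k)) / (\<Prod>k=1..m. Gamma (real (n k)))
             * ((\<Prod>k=2..m. s k ^ (n k - 1)) / (1 + (\<Sum>k=2..m. s k)) ^ (\<Sum>k=1..m. n k))
      else 0)"

text \<open>\<open>(X\<^sub>2, \<dots>, X\<^sub>m) \<sim> ID(n\<^sub>2, \<dots>, n\<^sub>m; n\<^sub>1)\<close>, the reference measure being Lebesgue measure on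
  the functions from \<open>{2..m}\<close> to the reals, that is, on \<open>\<real>\<^bsup>m-1\<^esup>\<close>.\<close>

definition inverted_dirichlet ::
    "'a measure \<Rightarrow> nat \<Rightarrow> (nat \<Rightarrow> 'a \<Rightarrow> real) \<Rightarrow> (nat \<Rightarrow> nat) \<Rightarrow> bool" where
  "inverted_dirichlet M m X n \<longleftrightarrow>
     distributed M (Pi\<^sub>M {2..m} (\<lambda>_. lborel)) (\<lambda>\<omega>. \<lambda>k\<in>{2..m}. X k \<omega>)
       (\<lambda>s. ennreal (inverted_dirichlet_density m n s))"

end

theory Submission
  imports Defs
begin

text \<open>Write \<open>X\<^sub>k = G\<^sub>k / T\<close> with independent standard gamma variables: conditionally on \<open>T = t\<close>, the
  coordinates are independent Erlang variables of rate \<open>t\<close>, whose tail at \<open>a\<close> is the probability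
  that a Poisson variable of mean \<open>t a\<close> is smaller than the shape parameter. Integrating products of
  Poisson weights against the gamma law of \<open>T\<close> yields the negative multinomial weights.\<close>

section \<open>Total mass and tails of Erlang laws\<close>

lemma nn_integral_erlang_density_UNIV:
  "0 < l \<Longrightarrow> (\<integral>\<^sup>+x. ennreal (erlang_density k l x) \<partial>lborel) = 1"
  using nn_integral_erlang_ith_moment[of l k 0] by simp

text \<open>Index \<open>k\<close> means shape k + 1: the law is that of arrival k + 1 in a Poisson
  process of rate \<open>l\<close>, which comes after \<open>a\<close> iff at most \<open>k\<close>
  arrivals occur up to \<open>a\<close>. Formally, the closed form of \<open>erlang_CDF\<close> is
  complemented.\<close>

lemma nn_integral_erlang_density_tail:
  assumes "0 < l" "0 \<le> a"
  shows "(\<integral>\<^sup>+x. ennreal (erlang_density k l x) * indicator {a<..} x \<partial>lborel)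
       = ennreal (\<Sum>j\<le>k. (l * a) ^ j * exp (- l * a) / fact j)"
proof -
  let ?D = "density lborel (erlang_density k l)"
  interpret prob_space ?D
    using assms(1) by (rule prob_space_erlang_density)
  have cdf: "emeasure ?D {..a} = ennreal (erlang_CDF k l a)"
    using assms by (intro emeasure_erlang_density) auto
  have "0 \<le> erlang_CDF k l a"
    using assms by (simp add: erlang_CDF_nonneg)
  then have "prob {..a} = erlang_CDF k l a"
    using cdf by (simp add: measure_def)
  then have "prob (space ?D - {..a}) = 1 - erlang_CDF k l a"
    by (subst prob_compl) auto
  moreover have "space ?D - {..a} = {a<..}"
    by auto
  ultimately have "emeasure ?D {a<..} = ennreal (1 - erlang_CDF k l a)"
    by (simp add: emeasure_eq_measure)
  then show ?thesis
    using assms by (simp add: emeasure_density erlang_CDF_def)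
qed

section \<open>Gamma mixing identities\<close>

text \<open>Gamma conjugacy: a factor t^d exp(-tS) raises the shape by \<open>d\<close> and the rate
  by \<open>S\<close>, and the coefficient compensates for the changed normalisation.
  \<open>P\<close> and \<open>F\<close> carry the factors free of \<open>t\<close>, so that both
  identities below are instances.\<close>

lemma erlang_density_mult_gamma_kernel:
  assumes "0 \<le> S"
  shows "erlang_density r 1 t * (t ^ d * P * exp (- t * S) / F)
    = fact (r + d) / (fact r * F) * (P / (1 + S) ^ Suc (r + d)) * erlang_density (r + d) (1 + S) t"
proof (cases "t < 0")
  case True
  then show ?thesis by (simp add: erlang_density_def)
next
  case False
  \<comment> \<open>A name for the rate keeps its powers from being expanded before they
    cancel.\<close>
  define L where "L = 1 + S"
  then have "0 < L" "- t * S = t - L * t"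
    using assms by (simp_all add: algebra_simps)
  then show ?thesis
    using False
    by (simp add: erlang_density_def L_def[symmetric] power_add exp_diff exp_minus field_simps
        del: power_Suc)
qed

text \<open>Bayes' rule for the joint density of T and X: as a function of the rate
  \<open>t\<close>, each factor is a multiple of t^(q k + 1) exp(-t s k). The coefficient is the
  inverted Dirichlet density and the last factor the law of T given X = s.\<close>

lemma erlang_density_mult_prod_erlang_density:
  assumes "finite I" and s: "\<And>k. k \<in> I \<Longrightarrow> 0 \<le> s k"
  shows "erlang_density r 1 t * (\<Prod>k\<in>I. erlang_density (q k) t (s k))
    = fact (r + (\<Sum>k\<in>I. Suc (q k))) / (fact r * (\<Prod>k\<in>I. fact (q k)))
        * ((\<Prod>k\<in>I. s k ^ q k) / (1 + (\<Sum>k\<in>I. s k)) ^ Suc (r + (\<Sum>k\<in>I. Suc (q k))))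
        * erlang_density (r + (\<Sum>k\<in>I. Suc (q k))) (1 + (\<Sum>k\<in>I. s k)) t"
proof -
  have "(\<Prod>k\<in>I. erlang_density (q k) t (s k))
      = (\<Prod>k\<in>I. t ^ Suc (q k) * s k ^ q k * exp (- t * s k) / fact (q k))"
    by (intro prod.cong refl) (simp add: erlang_density_def leD[OF s])
  also have "\<dots> = t ^ (\<Sum>k\<in>I. Suc (q k)) * (\<Prod>k\<in>I. s k ^ q k) * exp (- t * (\<Sum>k\<in>I. s k))
      / (\<Prod>k\<in>I. fact (q k))"
    using assms(1)
    by (simp only: prod.distrib prod_dividef power_sum exp_sum[symmetric] sum_distrib_left)
  finally show ?thesis
    using s by (simp only: erlang_density_mult_gamma_kernel sum_nonneg)
qed

text \<open>The same conjugacy for Poisson weights of means \<open>t * a k\<close>; the coefficient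
  becomes the negative multinomial mass once a k = p k / p 1.\<close>

lemma erlang_density_mult_prod_poisson:
  assumes "finite I" and a: "\<And>k. k \<in> I \<Longrightarrow> 0 \<le> a k"
  shows "erlang_density r 1 t * (\<Prod>k\<in>I. (t * a k) ^ j k * exp (- t * a k) / fact (j k))
    = fact (r + (\<Sum>k\<in>I. j k)) / (fact r * (\<Prod>k\<in>I. fact (j k)))
        * ((\<Prod>k\<in>I. a k ^ j k) / (1 + (\<Sum>k\<in>I. a k)) ^ Suc (r + (\<Sum>k\<in>I. j k)))
        * erlang_density (r + (\<Sum>k\<in>I. j k)) (1 + (\<Sum>k\<in>I. a k)) t"
proof -
  have "(\<Prod>k\<in>I. (t * a k) ^ j k * exp (- t * a k) / fact (j k))
      = t ^ (\<Sum>k\<in>I. j k) * (\<Prod>k\<in>I. a k ^ j k) * exp (- t * (\<Sum>k\<in>I. a k)) / (\<Prod>k\<in>I. fact (j k))"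
    using assms(1)
    by (simp only: prod.distrib prod_dividef power_sum power_mult_distrib exp_sum[symmetric]
        sum_distrib_left)
  then show ?thesis
    using a by (simp only: erlang_density_mult_gamma_kernel sum_nonneg)
qed

section \<open>The inverted Dirichlet mass of an upper orthant\<close>

text \<open>Both sides are the double integral of \<open>?g\<close>: integrating over
  \<open>t\<close> first gives the left side, over \<open>s\<close> first the right side. With r = n
  1 - 1 and q k = n k - 1 all Gamma values are factorials.\<close>

lemma nn_integral_inverted_dirichlet_upper_orthant:
  fixes a :: "'i \<Rightarrow> real"
  assumes fin: "finite I" and a: "\<And>k. k \<in> I \<Longrightarrow> 0 \<le> a k"
  shows "(\<integral>\<^sup>+s. ennreal (fact (r + (\<Sum>k\<in>I. Suc (q k))) / (fact r * (\<Prod>k\<in>I. fact (q k)))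
            * ((\<Prod>k\<in>I. s k ^ q k) / (1 + (\<Sum>k\<in>I. s k)) ^ Suc (r + (\<Sum>k\<in>I. Suc (q k)))))
          * indicator {s. \<forall>k\<in>I. a k < s k} s \<partial>Pi\<^sub>M I (\<lambda>_. lborel))
       = ennreal (\<Sum>j\<in>PiE I (\<lambda>k. {..q k}).
            fact (r + (\<Sum>k\<in>I. j k)) / (fact r * (\<Prod>k\<in>I. fact (j k)))
            * ((\<Prod>k\<in>I. a k ^ j k) / (1 + (\<Sum>k\<in>I. a k)) ^ Suc (r + (\<Sum>k\<in>I. j k))))"
    (is "(\<integral>\<^sup>+s. ennreal (?d s) * indicator ?O s \<partial>?P) = ennreal (\<Sum>j\<in>?J. ?w j)")
proof -
  interpret product_sigma_finite "\<lambda>_::'i. lborel :: real measure"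
    by standard
  interpret P: sigma_finite_measure ?P
    by (rule sigma_finite) (rule fin)
  interpret pair_sigma_finite lborel ?P
    by standard
  let ?f = "\<lambda>t k x. ennreal (erlang_density (q k) t x) * indicator {a k<..} x"
  let ?g = "\<lambda>t s. ennreal (erlang_density r 1 t) * (\<Prod>k\<in>I. ?f t k (s k))"
  have w: "0 \<le> ?w j" for j
    using a by (intro mult_nonneg_nonneg divide_nonneg_nonneg prod_nonneg zero_le_power
        add_nonneg_nonneg sum_nonneg) auto
  have pos: "0 < 1 + (\<Sum>k\<in>I. a k)"
    using a by (simp add: add_pos_nonneg sum_nonneg)
  have "ennreal (?d s) * indicator ?O s = (\<integral>\<^sup>+t. ?g t s \<partial>lborel)" for s
  proof (cases "\<forall>k\<in>I. a k < s k")
    case False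
    then obtain k where "k \<in> I" "\<not> a k < s k" by auto
    then have zero: "(\<Prod>k\<in>I. ?f t k (s k)) = 0" for t
      using fin by (intro prod_zero bexI[of _ k]) auto
    show ?thesis unfolding zero using False by simp
  next
    case True
    then have s: "\<And>k. k \<in> I \<Longrightarrow> 0 \<le> s k"
      using a by (meson less_eq_real_def order_trans)
    have d: "0 \<le> ?d s"
      using s by (intro mult_nonneg_nonneg divide_nonneg_nonneg prod_nonneg zero_le_power
          add_nonneg_nonneg sum_nonneg) auto
    have pos: "0 < 1 + (\<Sum>k\<in>I. s k)"
      using s by (simp add: add_pos_nonneg sum_nonneg)
    have "?g t s = ennreal (?d s) *
        ennreal (erlang_density (r + (\<Sum>k\<in>I. Suc (q k))) (1 + (\<Sum>k\<in>I. s k)) t)" for t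
    \<comment> \<open>For negative \<open>t\<close> the factors with rate \<open>t\<close> may be
      negative, so the product cannot be moved inside \<open>ennreal\<close>; there the density of T
      is zero on both sides.\<close>
    proof (cases "t < 0")
      case True
      then show ?thesis by (simp add: erlang_density_def)
    next
      case False
      have "(\<Prod>k\<in>I. ?f t k (s k)) = (\<Prod>k\<in>I. ennreal (erlang_density (q k) t (s k)))"
        using True by (intro prod.cong) auto
      also have "\<dots> = ennreal (\<Prod>k\<in>I. erlang_density (q k) t (s k))"
        using False s by (intro prod_ennreal) (auto simp: erlang_density_def)
      finally have "?g t s
          = ennreal (erlang_density r 1 t * (\<Prod>k\<in>I. erlang_density (q k) t (s k)))"
        by (simp add: ennreal_mult')
      also have "\<dots> = ennreal (?d s
          * erlang_density (r + (\<Sum>k\<in>I. Suc (q k))) (1 + (\<Sum>k\<in>I. s k)) t)"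
        by (subst erlang_density_mult_prod_erlang_density[OF fin s]) auto
      finally show ?thesis
        using d by (simp only: ennreal_mult')
    qed
    then show ?thesis
      using True pos by (simp add: nn_integral_cmult nn_integral_erlang_density_UNIV)
  qed
  then have "(\<integral>\<^sup>+s. ennreal (?d s) * indicator ?O s \<partial>?P) = (\<integral>\<^sup>+s. \<integral>\<^sup>+t. ?g t s \<partial>lborel \<partial>?P)"
    by simp
  \<comment> \<open>Tonelli; \<open>erlang_density\<close> is unfolded because \<open>t\<close>
    enters as a rate and joint measurability is required.\<close>
  also have "\<dots> = (\<integral>\<^sup>+t. \<integral>\<^sup>+s. ?g t s \<partial>?P \<partial>lborel)"
  proof (rule Fubini')
    show "case_prod ?g \<in> borel_measurable (lborel \<Otimes>\<^sub>M ?P)"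
      unfolding erlang_density_def using fin by measurable
  qed
  also have "\<dots> = (\<integral>\<^sup>+t. ennreal (erlang_density r 1 t) * (\<Prod>k\<in>I. \<integral>\<^sup>+x. ?f t k x \<partial>lborel) \<partial>lborel)"
  proof (intro nn_integral_cong)
    fix t
    have "(\<integral>\<^sup>+s. ?g t s \<partial>?P)
        = ennreal (erlang_density r 1 t) * (\<integral>\<^sup>+s. (\<Prod>k\<in>I. ?f t k (s k)) \<partial>?P)"
      by (rule nn_integral_cmult) measurable
    also have "(\<integral>\<^sup>+s. (\<Prod>k\<in>I. ?f t k (s k)) \<partial>?P) = (\<Prod>k\<in>I. \<integral>\<^sup>+x. ?f t k x \<partial>lborel)"
      by (rule product_nn_integral_prod[OF fin, of "?f t"]) measurable
    finally show "(\<integral>\<^sup>+s. ?g t s \<partial>?P)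
        = ennreal (erlang_density r 1 t) * (\<Prod>k\<in>I. \<integral>\<^sup>+x. ?f t k x \<partial>lborel)" .
  qed
  also have "\<dots> = (\<integral>\<^sup>+t. (\<Sum>j\<in>?J. ennreal (?w j)
      * ennreal (erlang_density (r + (\<Sum>k\<in>I. j k)) (1 + (\<Sum>k\<in>I. a k)) t)) \<partial>lborel)"
  \<comment> \<open>The tail formula needs a positive rate: at \<open>t = 0\<close> the Erlang
    density vanishes identically while the Poisson sum is 1. This single point is a null
    set.\<close>
  proof (intro nn_integral_cong_AE)
    have "ennreal (erlang_density r 1 t) * (\<Prod>k\<in>I. \<integral>\<^sup>+x. ?f t k x \<partial>lborel)
        = (\<Sum>j\<in>?J. ennreal (?w j)
            * ennreal (erlang_density (r + (\<Sum>k\<in>I. j k)) (1 + (\<Sum>k\<in>I. a k)) t))"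
      if "t \<noteq> 0" for t
    proof (cases "t < 0")
      case True
      then show ?thesis by (simp add: erlang_density_def)
    next
      case False
      with that have t: "0 < t" by simp
      have "(\<Prod>k\<in>I. \<integral>\<^sup>+x. ?f t k x \<partial>lborel)
          = (\<Prod>k\<in>I. ennreal (\<Sum>j\<le>q k. (t * a k) ^ j * exp (- t * a k) / fact j))"
        using t a by (intro prod.cong refl nn_integral_erlang_density_tail) auto
      also have "\<dots> = ennreal (\<Prod>k\<in>I. \<Sum>j\<le>q k. (t * a k) ^ j * exp (- t * a k) / fact j)"
        using t a by (intro prod_ennreal sum_nonneg) auto
      finally have "ennreal (erlang_density r 1 t) * (\<Prod>k\<in>I. \<integral>\<^sup>+x. ?f t k x \<partial>lborel)
          = ennreal (erlang_density r 1 t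
              * (\<Prod>k\<in>I. \<Sum>j\<le>q k. (t * a k) ^ j * exp (- t * a k) / fact j))"
        by (simp add: ennreal_mult')
      \<comment> \<open>Expanding the product of sums gives one term for each choice of a Poisson
        count in every coordinate.\<close>
      also have "\<dots> = ennreal (\<Sum>j\<in>?J. erlang_density r 1 t
              * (\<Prod>k\<in>I. (t * a k) ^ j k * exp (- t * a k) / fact (j k)))"
        by (subst prod_sum_PiE) (auto simp: fin sum_distrib_left)
      also have "\<dots> = ennreal (\<Sum>j\<in>?J. ?w j
              * erlang_density (r + (\<Sum>k\<in>I. j k)) (1 + (\<Sum>k\<in>I. a k)) t)"
        by (simp only: erlang_density_mult_prod_poisson[OF fin a])
      also have "\<dots> = (\<Sum>j\<in>?J. ennreal (?w j
              * erlang_density (r + (\<Sum>k\<in>I. j k)) (1 + (\<Sum>k\<in>I. a k)) t))"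
        using pos
        by (intro sum_ennreal[symmetric] mult_nonneg_nonneg[OF w] erlang_density_nonneg) simp
      finally show ?thesis
        using w by (simp only: ennreal_mult')
    qed
    moreover have "AE t in lborel. t \<noteq> (0::real)"
      by (rule AE_lborel_singleton)
    ultimately show "AE t in lborel. ennreal (erlang_density r 1 t) * (\<Prod>k\<in>I. \<integral>\<^sup>+x. ?f t k x \<partial>lborel)
        = (\<Sum>j\<in>?J. ennreal (?w j)
            * ennreal (erlang_density (r + (\<Sum>k\<in>I. j k)) (1 + (\<Sum>k\<in>I. a k)) t))"
      by (auto elim: eventually_mono)
  qed
  also have "\<dots> = (\<Sum>j\<in>?J. ennreal (?w j))"
    using pos by (simp add: nn_integral_sum nn_integral_cmult nn_integral_erlang_density_UNIV)
  also have "\<dots> = ennreal (\<Sum>j\<in>?J. ?w j)"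
    by (intro sum_ennreal w)
  finally show ?thesis .
qed

section \<open>The negative multinomial mass of a lower orthant\<close>

lemma neg_multinomial_lower_orthant:
  assumes "prob_space M" and A: "neg_multinomial M m A n1 p"
  shows "\<P>(\<omega> in M. \<forall>k\<in>{2..m}. A k \<omega> \<le> q k)
       = (\<Sum>j\<in>PiE {2..m} (\<lambda>k. {..q k}). neg_multinomial_mass m n1 p j)"
proof -
  interpret prob_space M by fact
  let ?J = "PiE {2..m} (\<lambda>k. {..q k})"
  let ?E = "\<lambda>j. {\<omega> \<in> space M. \<forall>k\<in>{2..m}. A k \<omega> = j k}"
  have [measurable]: "A k \<in> measurable M (count_space UNIV)" if "k \<in> {2..m}" for k
    using A that by (simp add: neg_multinomial_def)
  have "?E j \<in> events" for j
    by measurable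
  moreover have "disjoint_family_on ?E ?J"
  proof (unfold disjoint_family_on_def, intro ballI impI)
    fix i j assume "i \<in> ?J" "j \<in> ?J" "i \<noteq> j"
    \<comment> \<open>Members of \<open>?J\<close> agree outside \<open>{2..m}\<close>, so distinct
      ones already differ at an index that the events see.\<close>
    then obtain k where "k \<in> {2..m}" "i k \<noteq> j k"
      using PiE_ext by blast
    then show "?E i \<inter> ?E j = {}"
      by fastforce
  qed
  moreover have "{\<omega> \<in> space M. \<forall>k\<in>{2..m}. A k \<omega> \<le> q k} = (\<Union>j\<in>?J. ?E j)"
  proof (intro equalityI subsetI)
    fix \<omega> assume "\<omega> \<in> {\<omega> \<in> space M. \<forall>k\<in>{2..m}. A k \<omega> \<le> q k}"
    then show "\<omega> \<in> (\<Union>j\<in>?J. ?E j)"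
      by (intro UN_I[of "\<lambda>k\<in>{2..m}. A k \<omega>"]) auto
  next
    fix \<omega> assume "\<omega> \<in> (\<Union>j\<in>?J. ?E j)"
    then show "\<omega> \<in> {\<omega> \<in> space M. \<forall>k\<in>{2..m}. A k \<omega> \<le> q k}"
      by (auto simp: PiE_iff)
  qed
  moreover have "finite ?J"
    by (intro finite_PiE) auto
  ultimately have "\<P>(\<omega> in M. \<forall>k\<in>{2..m}. A k \<omega> \<le> q k) = (\<Sum>j\<in>?J. prob (?E j))"
    by (simp only:) (intro finite_measure_finite_Union, auto)
  then show ?thesis
    using A by (simp add: neg_multinomial_def)
qed

section \<open>Matching the parameters of the two laws\<close>

theorem lemma13:
  fixes M :: "'a measure" and N :: "'b measure"
    and m :: nat and n :: "nat \<Rightarrow> nat" and p :: "nat \<Rightarrow> real"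
    and A :: "nat \<Rightarrow> 'a \<Rightarrow> nat" and X :: "nat \<Rightarrow> 'b \<Rightarrow> real"
  assumes "prob_space M" and "prob_space N"
    and "m \<ge> 2"
    and "\<And>k. k \<in> {1..m} \<Longrightarrow> n k \<ge> 1"
    and "\<And>k. k \<in> {1..m} \<Longrightarrow> p k \<in> {0<..<1}"
    and "(\<Sum>k=1..m. p k) = 1"
    and "neg_multinomial M m A (n 1) p"
    and "inverted_dirichlet N m X n"
  shows "\<P>(\<omega> in M. \<forall>k\<in>{2..m}. A k \<omega> \<le> n k - 1)
       = \<P>(\<omega> in N. \<forall>k\<in>{2..m}. X k \<omega> > p k / p 1)"
proof -
  interpret N: prob_space N by fact
  let ?I = "{2..m}" and ?a = "\<lambda>k. p k / p 1"
  \<comment> \<open>Erlang indices are shapes minus one; as every \<open>n k\<close> is at least 1,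
    the subtraction is not truncated.\<close>
  define r where "r = n 1 - 1"
  define q where "q k = n k - 1" for k
  have I: "{1..m} = insert 1 ?I"
    using assms(3) by auto
  have n1: "n 1 = Suc r"
    using assms(3) assms(4)[of 1] by (simp add: r_def)
  have n: "n k = Suc (q k)" if "k \<in> ?I" for k
    using that assms(4)[of k] by (simp add: q_def)
  have sumn: "(\<Sum>k=1..m. n k) = Suc (r + (\<Sum>k\<in>?I. Suc (q k)))"
    unfolding I using n1 n by simp
  have p1: "0 < p 1" and p: "\<And>k. k \<in> ?I \<Longrightarrow> 0 < p k"
    using assms(3,5) by auto
  have sump: "1 - (\<Sum>k\<in>?I. p k) = p 1"
    using assms(6) unfolding I by simp
  then have suma: "1 + (\<Sum>k\<in>?I. ?a k) = 1 / p 1"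
    using p1 by (simp add: sum_divide_distrib[symmetric] field_simps)
  let ?O = "{s. \<forall>k\<in>?I. ?a k < s k}"
  let ?P = "Pi\<^sub>M ?I (\<lambda>_. lborel :: real measure)"

  \<comment> \<open>By \<open>suma\<close> the denominator contributes p 1 to the power n 1 plus the
    sum of the \<open>j k\<close>; the denominators of \<open>?a k ^ j k\<close> cancel all but the
    power n 1.\<close>
  have mass: "fact (r + (\<Sum>k\<in>?I. j k)) / (fact r * (\<Prod>k\<in>?I. fact (j k)))
        * ((\<Prod>k\<in>?I. ?a k ^ j k) / (1 + (\<Sum>k\<in>?I. ?a k)) ^ Suc (r + (\<Sum>k\<in>?I. j k)))
      = neg_multinomial_mass m (n 1) p j" for j
    unfolding neg_multinomial_mass_def suma sump n1 using p1
    by (simp add: power_divide prod_dividef power_sum[symmetric] power_add field_simps)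

  \<comment> \<open>The formulas are compared only on \<open>?O\<close>: the thresholds are
    positive, so there the density is in its nonzero branch.\<close>
  have dens: "ennreal (inverted_dirichlet_density m n s) * indicator ?O s
      = ennreal (fact (r + (\<Sum>k\<in>?I. Suc (q k))) / (fact r * (\<Prod>k\<in>?I. fact (q k)))
            * ((\<Prod>k\<in>?I. s k ^ q k) / (1 + (\<Sum>k\<in>?I. s k)) ^ Suc (r + (\<Sum>k\<in>?I. Suc (q k)))))
          * indicator ?O s" for s
  proof (cases "s \<in> ?O")
    case True
    have "0 \<le> s k" if "k \<in> ?I" for k
    proof -
      have "0 < ?a k" using p[OF that] p1 by simp
      also have "?a k < s k" using True that by simp
      finally show ?thesis by simp
    qed
    moreover have "(\<Prod>k\<in>{1..m}. Gamma (real (n k))) = fact r * (\<Prod>k\<in>?I. fact (q k))"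
      unfolding I using n1 n Gamma_fact[where 'a = real] by (simp add: add.commute)
    moreover have "(\<Prod>k\<in>?I. s k ^ (n k - 1)) = (\<Prod>k\<in>?I. s k ^ q k)"
      by (simp add: q_def)
    moreover have "Gamma (real (\<Sum>k=1..m. n k)) = fact (r + (\<Sum>k\<in>?I. Suc (q k)))"
      unfolding sumn using Gamma_fact[where 'a = real, of "r + (\<Sum>k\<in>?I. Suc (q k))"]
      by (simp only: of_nat_Suc)
    ultimately show ?thesis
      unfolding inverted_dirichlet_density_def by (simp only: sumn) simp
  qed auto

  have X: "distributed N ?P (\<lambda>\<omega>. \<lambda>k\<in>?I. X k \<omega>) (\<lambda>s. ennreal (inverted_dirichlet_density m n s))"
    using assms(8) by (simp add: inverted_dirichlet_def)
  have "{s \<in> space ?P. \<forall>k\<in>?I. ?a k < s k} \<in> sets ?P"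
    by measurable
  \<comment> \<open>\<open>?O\<close> also contains functions that are not extensional on
    \<open>?I\<close>, so it is cut down to the space of \<open>?P\<close>.\<close>
  then have O: "?O \<inter> space ?P \<in> sets ?P"
    by (simp add: Int_def conj_commute)
  have "{\<omega> \<in> space N. \<forall>k\<in>?I. ?a k < X k \<omega>}
      = (\<lambda>\<omega>. \<lambda>k\<in>?I. X k \<omega>) -` (?O \<inter> space ?P) \<inter> space N"
    by (auto simp: space_PiM)
  then have "emeasure N {\<omega> \<in> space N. \<forall>k\<in>?I. ?a k < X k \<omega>}
      = (\<integral>\<^sup>+s. ennreal (inverted_dirichlet_density m n s) * indicator (?O \<inter> space ?P) s \<partial>?P)"
    using distributed_emeasure[OF X O] by simp
  also have "\<dots> = (\<integral>\<^sup>+s. ennreal (inverted_dirichlet_density m n s) * indicator ?O s \<partial>?P)"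
    by (intro nn_integral_cong) (auto split: split_indicator)
  also have "\<dots> = ennreal (\<Sum>j\<in>PiE ?I (\<lambda>k. {..q k}). neg_multinomial_mass m (n 1) p j)"
    unfolding dens mass[symmetric] using p p1
    by (intro nn_integral_inverted_dirichlet_upper_orthant) (auto simp: less_imp_le)
  also have "\<dots> = ennreal \<P>(\<omega> in M. \<forall>k\<in>?I. A k \<omega> \<le> q k)"
    using neg_multinomial_lower_orthant[OF assms(1,7)] by simp
  finally show ?thesis
    by (simp add: N.emeasure_eq_measure q_def)
qed

end
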